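(* Let $X_0, X_1, X_2, \ldots$ be a Markov process with state space $S$, where $X_0$ is a constant. Let $f$ be a non-negative real-valued function on $S$ such that, for all $t$, $\Pr[f(X_t) - f(X_{t+1}) \ge 0 \mid X_t] = 1$. Let $U$ and $\epsilon$ be constants such that for every state $x$ with $f(x) > 0$ and every $t$, $\Pr[f(X_t) - f(X_{t+1}) \ge U \mid X_t = x] \le \epsilon$. Let $\tau = \min\{ t : f(X_t) = 0\}$. For each $x \in S$ with $f(x) > 0$, let $\mu_x > 0$ satisfy $\mu_x \ge \mathbb{E}[f(X_t) - f(X_{t+1}) \mid X_t = x,\ f(X_t) - f(X_{t+1}) < U]$. Define $m_z = \sup\{\mu_x : x \in S,\ f(x) \in [z, z+U)\}$ and $T(x) = \int_0^{f(x)} \frac{1}{m_z}\, dz$. Then $$\mathbb{E}[\tau] \ge \frac{T(X_0)}{\epsilon\, T(X_0) + (1-\epsilon)}.$$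
   Formalization: The formal theorem assumes ε ≤ 1; for ε > 1 the claim can fail (one state with f=1 jumping to 0 at once, U=2, μ=5/3, ε=2: bound 3 but E[τ]=1). When T(X_0) is infinite the ratio is read as its limit 1/ε. *)

theory Defs
  imports "HOL-Probability.Probability"
begin

definition natural_filtration ::
  "'a measure \<Rightarrow> 'b measure \<Rightarrow> (nat \<Rightarrow> 'a \<Rightarrow> 'b) \<Rightarrow> nat \<Rightarrow> 'a measure" where
  "natural_filtration P M X t =
     sigma (space P) {X s -` A \<inter> space P | s A. s \<le> t \<and> A \<in> sets M}"

text \<open>
  A discrete-time, not necessarily time-homogeneous, Markov process on the measurable state
  space \<open>M\<close>. The probability measure \<open>K t x\<close> is the law of \<open>X (Suc t)\<close> conditioned on \<open>X t = x\<close>;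
  on a general state space this is the meaning given to conditioning on the (possibly null)
  event \<open>X t = x\<close>. The last assumption is the Markov property: given the whole past up
  to time \<open>t\<close>, the law of \<open>X (Suc t)\<close> is \<open>K t (X t)\<close>.
\<close>

locale markov_process = prob_space P
  for P :: "'a measure" and M :: "'b measure"
    and X :: "nat \<Rightarrow> 'a \<Rightarrow> 'b" and K :: "nat \<Rightarrow> 'b \<Rightarrow> 'b measure" +
  assumes random_variable_X: "\<And>t. X t \<in> measurable P M"
    and kernel_K: "\<And>t. K t \<in> measurable M (prob_algebra M)"
    and markov_property: "\<And>t A. A \<in> sets M \<Longrightarrow>
      AE \<omega> in P. real_cond_exp P (natural_filtration P M X t)
                   (indicator (X (Suc t) -` A \<inter> space P)) \<omega> = measure (K t (X t \<omega>)) A"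

text \<open>The infimum of the empty set is \<open>\<infinity>\<close>, i.e. the hitting time is infinite if zero is never hit.\<close>

definition hitting_time_zero :: "('b \<Rightarrow> real) \<Rightarrow> (nat \<Rightarrow> 'a \<Rightarrow> 'b) \<Rightarrow> 'a \<Rightarrow> enat" where
  "hitting_time_zero f X \<omega> = Inf {enat t | t. f (X t \<omega>) = 0}"

text \<open>
  Conditional expectation given an event: \<open>uniform_measure N A\<close> is \<open>N\<close> conditioned on \<open>A\<close>.
  If \<open>A\<close> is a null set, the value is \<open>0\<close>.
\<close>

definition cond_expectation :: "'b measure \<Rightarrow> ('b \<Rightarrow> real) \<Rightarrow> ('b \<Rightarrow> bool) \<Rightarrow> real" where
  "cond_expectation N g Q = (\<integral>y. g y \<partial>uniform_measure N {y \<in> space N. Q y})"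

text \<open>
  The supremum is taken in the extended nonnegative reals, so that it is \<open>\<infinity>\<close> for an unbounded
  set and \<open>0\<close> for the empty set, with reciprocals \<open>0\<close> and \<open>\<infinity>\<close>.
\<close>

definition drift_sup :: "'b measure \<Rightarrow> ('b \<Rightarrow> real) \<Rightarrow> real \<Rightarrow> ('b \<Rightarrow> real) \<Rightarrow> real \<Rightarrow> ennreal" where
  "drift_sup M f U \<mu> z = (SUP x \<in> {x \<in> space M. f x \<in> {z..<z + U}}. ennreal (\<mu> x))"

definition drift_potential ::
  "'b measure \<Rightarrow> ('b \<Rightarrow> real) \<Rightarrow> real \<Rightarrow> ('b \<Rightarrow> real) \<Rightarrow> 'b \<Rightarrow> ennreal" where
  "drift_potential M f U \<mu> x = (\<integral>\<^sup>+ z \<in> {0..f x}. 1 / drift_sup M f U \<mu> z \<partial>lborel)"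

end

theory Submission
  imports Defs
begin

text \<open>
  Put \<open>h(a) = a / (\<epsilon> a + 1 - \<epsilon>)\<close>, a concave function with \<open>h(0) = 0\<close>. A step of size below \<open>U\<close>
  from \<open>x\<close> only crosses levels \<open>z\<close> with \<open>\<mu>\<^sub>x \<le> m\<^sub>z\<close>, so it lowers \<open>T\<close> by at most its size divided by
  \<open>\<mu>\<^sub>x\<close>, hence by at most \<open>1\<close> in conditional expectation. A larger step happens with probability at
  most \<open>\<epsilon>\<close> and costs at most the whole of \<open>h(T)\<close>. Together, \<open>h(T(X\<^sub>t))\<close> decreases by at most \<open>1\<close> in
  expectation per step before \<open>\<tau>\<close>, and summing over \<open>t\<close> gives \<open>h(T(X\<^sub>0)) \<le> E[\<tau>]\<close>.

  \<open>T\<close> may be infinite, and \<open>z \<mapsto> m\<^sub>z\<close> is not obviously measurable. Both issues are bypassed by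
  running the argument with an arbitrary finite simple function below \<open>1 / m\<^sub>z\<close> in place of
  \<open>1 / m\<^sub>z\<close> and taking the supremum at the end.
\<close>

section \<open>Conditioning on the past and integration against the kernel\<close>

context markov_process
begin

lemma subalgebra_natural_filtration: "subalgebra P (natural_filtration P M X t)"
proof -
  have "{X s -` A \<inter> space P | s A. s \<le> t \<and> A \<in> sets M} \<subseteq> sets P"
    using random_variable_X by (auto intro: measurable_sets)
  then show ?thesis
    unfolding subalgebra_def natural_filtration_def
    by (intro conjI, simp add: space_measure_of_conv)
       (subst sets_measure_of, auto intro!: sets.sigma_sets_subset)
qed

lemma vimage_in_natural_filtration:
  "A \<in> sets M \<Longrightarrow> X t -` A \<inter> space P \<in> sets (natural_filtration P M X t)"
  unfolding natural_filtration_def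
  by (subst sets_measure_of) auto

lemma X_in_space: "\<omega> \<in> space P \<Longrightarrow> X t \<omega> \<in> space M"
  using random_variable_X by (auto dest: measurable_space)

lemma kernel_subprob: "K t \<in> measurable M (subprob_algebra M)"
  using kernel_K by (rule measurable_prob_algebraD)

lemma prob_space_kernel: "x \<in> space M \<Longrightarrow> prob_space (K t x)"
  using measurable_space[OF kernel_K] by (simp add: space_prob_algebra)

lemma sets_K: "x \<in> space M \<Longrightarrow> sets (K t x) = sets M"
  using measurable_space[OF kernel_K] by (simp add: space_prob_algebra)

text \<open>Since \<open>A\<close> belongs to the filtration at time \<open>t\<close>, the
  conditional probability of the next event has the same integral over \<open>A\<close> as its
  indicator. The Markov property replaces that conditional probability by the kernel.\<close>

lemma emeasure_past_Int_next:
  assumes A: "A \<in> sets (natural_filtration P M X t)" and B: "B \<in> sets M"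
  shows "emeasure P (A \<inter> (X (Suc t) -` B \<inter> space P))
         = (\<integral>\<^sup>+\<omega>\<in>A. emeasure (K t (X t \<omega>)) B \<partial>P)"
proof -
  let ?F = "natural_filtration P M X t"
  let ?C = "X (Suc t) -` B \<inter> space P"
  interpret F: finite_measure_subalgebra P ?F
    by unfold_locales (rule subalgebra_natural_filtration)
  have [measurable]: "A \<in> sets P"
    using A subalgebra_natural_filtration by (auto simp: subalgebra_def)
  have C[measurable]: "?C \<in> sets P"
    using random_variable_X B by (rule measurable_sets)
  have [measurable]: "(\<lambda>\<omega>. measure (K t (X t \<omega>)) B) \<in> borel_measurable P"
    using measurable_compose[OF random_variable_X
        measurable_compose[OF kernel_subprob measurable_measure_subprob_algebra[OF B]]] .
  have bound: "measure (K t (X t \<omega>)) B \<le> 1" if "\<omega> \<in> space P" for \<omega>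
    using prob_space.prob_le_1[OF prob_space_kernel[OF X_in_space[OF that]]] .
  have int: "integrable P (\<lambda>\<omega>. indicator A \<omega> * measure (K t (X t \<omega>)) B)"
    by (rule integrable_const_bound[of _ 1])
       (auto intro!: AE_I2 bound split: split_indicator)
  have "measure P (A \<inter> ?C) = (\<integral>\<omega>\<in>A. indicator ?C \<omega> \<partial>P)"
    by (simp add: set_lebesgue_integral_def indicator_inter_arith[symmetric] Int_assoc)
  also have "\<dots> = (\<integral>\<omega>\<in>A. real_cond_exp P ?F (indicator ?C) \<omega> \<partial>P)"
    using A C
    by (intro F.real_cond_exp_intA integrable_real_indicator) (auto simp: emeasure_eq_measure)
  also have "\<dots> = (\<integral>\<omega>\<in>A. measure (K t (X t \<omega>)) B \<partial>P)"
    using markov_property[OF B, of t] by (intro set_lebesgue_integral_cong_AE) auto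
  finally have "ennreal (measure P (A \<inter> ?C)) =
      (\<integral>\<^sup>+\<omega>. ennreal (indicator A \<omega> * measure (K t (X t \<omega>)) B) \<partial>P)"
    by (subst nn_integral_eq_integral[OF int]) (auto simp: set_lebesgue_integral_def)
  also have "\<dots> = (\<integral>\<^sup>+\<omega>\<in>A. emeasure (K t (X t \<omega>)) B \<partial>P)"
    by (intro nn_integral_cong)
       (auto simp: finite_measure.emeasure_eq_measure[OF prob_space.finite_measure[OF prob_space_kernel]]
          X_in_space split: split_indicator)
  finally show ?thesis
    by (simp add: emeasure_eq_measure)
qed

text \<open>This is the case where the past event is the whole space. Phrased through
  \<open>bind\<close>, it extends from indicators to all nonnegative measurable functions, which
  \<open>nn_integral_next\<close> exploits.\<close>

lemma distr_next_eq_bind: "distr P M (X (Suc t)) = distr P M (X t) \<bind> K t"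
proof (rule measure_eqI)
  have ne: "space (distr P M (X t)) \<noteq> {}"
    using not_empty X_in_space by auto
  have K: "K t \<in> measurable (distr P M (X t)) (subprob_algebra M)"
    using kernel_subprob by simp
  show "sets (distr P M (X (Suc t))) = sets (distr P M (X t) \<bind> K t)"
    using ne by (subst sets_bind[of _ _ M]) (auto simp: sets_K)
  fix B assume "B \<in> sets (distr P M (X (Suc t)))"
  then have B: "B \<in> sets M" by simp
  have "space P \<in> sets (natural_filtration P M X t)"
    using sets.top[of "natural_filtration P M X t"]
    by (simp add: natural_filtration_def space_measure_of_conv)
  from emeasure_past_Int_next[OF this B]
  have "emeasure P (X (Suc t) -` B \<inter> space P) = (\<integral>\<^sup>+\<omega>\<in>space P. emeasure (K t (X t \<omega>)) B \<partial>P)"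
    by (simp add: Int_absorb1)
  also have "\<dots> = (\<integral>\<^sup>+\<omega>. emeasure (K t (X t \<omega>)) B \<partial>P)"
    by (intro nn_integral_cong) simp
  finally show "emeasure (distr P M (X (Suc t))) B = emeasure (distr P M (X t) \<bind> K t) B"
    using ne B random_variable_X
    by (subst emeasure_bind[OF ne K B])
       (simp add: emeasure_distr nn_integral_distr
          measurable_compose[OF kernel_subprob measurable_emeasure_subprob_algebra])
qed

lemma nn_integral_next:
  assumes g: "g \<in> borel_measurable M"
  shows "(\<integral>\<^sup>+\<omega>. g (X (Suc t) \<omega>) \<partial>P) = (\<integral>\<^sup>+\<omega>. (\<integral>\<^sup>+y. g y \<partial>K t (X t \<omega>)) \<partial>P)"
proof -
  have K: "K t \<in> measurable (distr P M (X t)) (subprob_algebra M)"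
    using kernel_subprob by simp
  have "(\<integral>\<^sup>+\<omega>. g (X (Suc t) \<omega>) \<partial>P) = (\<integral>\<^sup>+y. g y \<partial>(distr P M (X t) \<bind> K t))"
    using g random_variable_X by (simp add: nn_integral_distr flip: distr_next_eq_bind)
  also have "\<dots> = (\<integral>\<^sup>+x. (\<integral>\<^sup>+y. g y \<partial>K t x) \<partial>distr P M (X t))"
    by (rule nn_integral_bind[OF g K])
  also have "\<dots> = (\<integral>\<^sup>+\<omega>. (\<integral>\<^sup>+y. g y \<partial>K t (X t \<omega>)) \<partial>P)"
    using random_variable_X
    by (intro nn_integral_distr)
       (simp_all add: measurable_compose[OF kernel_subprob nn_integral_measurable_subprob_algebra[OF g]])
  finally show ?thesis .
qed

text \<open>The descent hypothesis speaks of the kernel only. To carry it over to paths, the mass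
  that the kernel gives to \<open>f > 0\<close> is integrated over the past event
  \<open>f (X t) = 0\<close>. This mass vanishes almost surely there, so the set of paths leaving
  zero at time \<open>t\<close> is null.\<close>

lemma AE_zero_absorbing:
  fixes f :: "'b \<Rightarrow> real"
  assumes f[measurable]: "f \<in> borel_measurable M"
    and f_nonneg: "\<And>x. x \<in> space M \<Longrightarrow> f x \<ge> 0"
    and dec: "AE \<omega> in P. \<P>(y in K t (X t \<omega>). f (X t \<omega>) - f y \<ge> 0) = 1"
  shows "AE \<omega> in P. f (X t \<omega>) = 0 \<longrightarrow> f (X (Suc t) \<omega>) = 0"
proof -
  note [measurable] = random_variable_X
  define A where "A = X t -` {x \<in> space M. f x = 0} \<inter> space P"
  define B where "B = {x \<in> space M. f x > 0}"
  have B: "B \<in> sets M" unfolding B_def by measurable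
  have "emeasure P (A \<inter> (X (Suc t) -` B \<inter> space P))
        = (\<integral>\<^sup>+\<omega>\<in>A. emeasure (K t (X t \<omega>)) B \<partial>P)"
    unfolding A_def by (intro emeasure_past_Int_next vimage_in_natural_filtration B) simp
  also have "\<dots> = (\<integral>\<^sup>+\<omega>. 0 \<partial>P)"
  proof (rule nn_integral_cong_AE, use dec AE_space in eventually_elim)
    fix \<omega> assume *: "\<P>(y in K t (X t \<omega>). f (X t \<omega>) - f y \<ge> 0) = 1" and \<omega>: "\<omega> \<in> space P"
    interpret N: prob_space "K t (X t \<omega>)"
      by (rule prob_space_kernel[OF X_in_space[OF \<omega>]])
    note [measurable_cong] = sets_K[OF X_in_space[OF \<omega>]]
    have sp: "space (K t (X t \<omega>)) = space M"
      using sets_K[OF X_in_space[OF \<omega>]] by (rule sets_eq_imp_space_eq)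
    have "AE y in K t (X t \<omega>). f (X t \<omega>) - f y \<ge> 0"
      using * by (subst (asm) N.prob_Collect_eq_1) auto
    then have "f (X t \<omega>) = 0 \<Longrightarrow> AE y in K t (X t \<omega>). y \<notin> B"
      by eventually_elim (auto simp: B_def)
    then have "f (X t \<omega>) = 0 \<Longrightarrow> emeasure (K t (X t \<omega>)) B = 0"
      using B by (subst (asm) AE_iff_measurable[of B])
        (auto simp: sp sets_K[OF X_in_space[OF \<omega>]] B_def)
    then show "emeasure (K t (X t \<omega>)) B * indicator A \<omega> = 0"
      by (auto simp: A_def split: split_indicator)
  qed
  finally have 0: "emeasure P (A \<inter> (X (Suc t) -` B \<inter> space P)) = 0" by simp
  have "A \<inter> (X (Suc t) -` B \<inter> space P) \<in> sets P"
    using B unfolding A_def by measurable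
  with 0 have "AE \<omega> in P. \<omega> \<notin> A \<inter> (X (Suc t) -` B \<inter> space P)"
    by (intro AE_not_in) auto
  with AE_space show ?thesis
  proof eventually_elim
    fix \<omega> assume "\<omega> \<in> space P" "\<omega> \<notin> A \<inter> (X (Suc t) -` B \<inter> space P)"
    then show "f (X t \<omega>) = 0 \<longrightarrow> f (X (Suc t) \<omega>) = 0"
      using f_nonneg[of "X (Suc t) \<omega>"] X_in_space[of \<omega>] by (auto simp: A_def B_def)
  qed
qed

end

text \<open>Once a path has reached zero it stays there, so its nonzero times all lie strictly
  before the hitting time. In expectation this turns the hitting time into an upper bound for a sum
  of probabilities.\<close>

lemma hitting_time_zero_ge:
  assumes "\<And>t. f (X t \<omega>) = 0 \<Longrightarrow> f (X (Suc t) \<omega>) = 0"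
  shows "(\<Sum>t<n. indicator {t. f (X t \<omega>) \<noteq> 0} t) \<le> ennreal_of_enat (hitting_time_zero f X \<omega>)"
proof (cases "\<exists>t. f (X t \<omega>) = 0")
  case True
  let ?S = "{enat t | t. f (X t \<omega>) = 0}"
  from True obtain t where "enat t \<in> ?S" by blast
  then have "Inf ?S \<in> ?S" by (rule wellorder_InfI)
  then obtain k where k: "hitting_time_zero f X \<omega> = enat k" "f (X k \<omega>) = 0"
    by (auto simp: hitting_time_zero_def)
  have zero: "f (X t \<omega>) = 0" if "k \<le> t" for t
    using that by (induction rule: dec_induct) (use k assms in auto)
  have "(\<Sum>t<n. indicator {t. f (X t \<omega>) \<noteq> 0} t :: ennreal) = of_nat (card ({t. f (X t \<omega>) \<noteq> 0} \<inter> {..<n}))"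
    by (simp add: indicator_def Int_commute)
  also have "\<dots> \<le> of_nat (card {..<k})"
    using zero by (intro of_nat_mono card_mono) (auto simp: not_le[symmetric])
  finally show ?thesis using k by simp
next
  case False
  then show ?thesis by (simp add: hitting_time_zero_def)
qed

section \<open>The concave function applied to the potential\<close>

text \<open>For \<open>\<epsilon> = 1\<close>, \<open>a = 0\<close> the value is \<open>0 / 0 = 0\<close>.\<close>

definition saturation :: "real \<Rightarrow> real \<Rightarrow> real" where
  "saturation \<epsilon> a = a / (\<epsilon> * a + (1 - \<epsilon>))"

lemma measurable_saturation [measurable]: "saturation \<epsilon> \<in> borel_measurable borel"
  unfolding saturation_def by measurable

lemma saturation_zero [simp]: "saturation \<epsilon> 0 = 0"
  by (simp add: saturation_def)

lemma saturation_nonneg: "0 \<le> \<epsilon> \<Longrightarrow> \<epsilon> \<le> 1 \<Longrightarrow> 0 \<le> a \<Longrightarrow> 0 \<le> saturation \<epsilon> a"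
  unfolding saturation_def by simp

lemma saturation_denominator_pos:
  fixes \<epsilon> a :: real
  assumes "0 \<le> \<epsilon>" "\<epsilon> \<le> 1" "0 < a"
  shows "0 < \<epsilon> * a + (1 - \<epsilon>)"
  using assms by (cases "\<epsilon> = 0") (auto intro: add_pos_nonneg)

text \<open>A crude bound that, unlike \<open>1 / \<epsilon>\<close>, survives
  \<open>\<epsilon> = 0\<close>. It serves only to make bounded potentials integrable after
  saturation.\<close>

lemma saturation_le:
  assumes "0 \<le> \<epsilon>" "\<epsilon> \<le> 1" "0 \<le> a"
  shows "saturation \<epsilon> a \<le> 1 + a"
proof (cases "a = 0")
  case False
  have "a \<le> a + (1 - \<epsilon> + \<epsilon> * a\<^sup>2)"
    using assms by simp
  also have "\<dots> = (1 + a) * (\<epsilon> * a + (1 - \<epsilon>))"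
    by (simp add: algebra_simps power2_eq_square)
  finally show ?thesis
    using assms False saturation_denominator_pos[of \<epsilon> a]
    by (simp add: saturation_def pos_divide_le_eq)
qed simp

text \<open>Covers potentials at most \<open>1\<close>, for which the chord estimate would multiply
  an inequality by the nonpositive number \<open>a - 1\<close>.\<close>

lemma saturation_le_1:
  assumes "0 \<le> \<epsilon>" "\<epsilon> \<le> 1" "0 \<le> a" "a \<le> 1"
  shows "saturation \<epsilon> a \<le> 1"
proof (cases "a = 0")
  case False
  have "(1 - \<epsilon>) * a \<le> 1 - \<epsilon>"
    using assms by (intro mult_left_le) auto
  then show ?thesis
    using assms False saturation_denominator_pos[of \<epsilon> a]
    by (simp add: saturation_def pos_divide_le_eq algebra_simps)
qed simp

text \<open>The chord from the origin to the point at \<open>a\<close> has slope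
  \<open>1 / (\<epsilon> * a + (1 - \<epsilon>))\<close>. The denominator is nondecreasing in its
  argument, so at \<open>b\<close> it is no larger than at \<open>a\<close>.\<close>

lemma saturation_ge_chord:
  assumes "0 \<le> \<epsilon>" "\<epsilon> \<le> 1" "0 \<le> b" "b \<le> a"
  shows "b / (\<epsilon> * a + (1 - \<epsilon>)) \<le> saturation \<epsilon> b"
proof (cases "b = 0")
  case False
  then show ?thesis
    unfolding saturation_def
    using assms saturation_denominator_pos[of \<epsilon> b] saturation_denominator_pos[of \<epsilon> a]
    by (intro divide_left_mono) (auto intro: mult_left_mono)
qed simp

section \<open>The expected decrease in one step\<close>

text \<open>Multiplying by the probability makes the identity hold for null events too, where both
  sides are \<open>0\<close>. The drift estimate therefore needs no separate case in which steps
  below \<open>U\<close> have probability zero.\<close>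

lemma (in prob_space) cond_expectation_mult_prob:
  assumes g[measurable]: "g \<in> borel_measurable M" and Q[measurable]: "Measurable.pred M Q"
  shows "cond_expectation M g Q * prob {x \<in> space M. Q x}
         = (\<integral>x. indicator {x \<in> space M. Q x} x * g x \<partial>M)"
proof -
  let ?A = "{x \<in> space M. Q x}"
  have A: "?A \<in> events" by measurable
  show ?thesis
  proof (cases "prob ?A = 0")
    case True
    with A have "AE x in M. x \<notin> ?A"
      by (intro AE_not_in) (auto simp: null_sets_def emeasure_eq_measure)
    then have "(\<integral>x. indicator ?A x * g x \<partial>M) = (\<integral>x. 0 \<partial>M)"
      by (intro integral_cong_AE) (auto split: split_indicator)
    with True show ?thesis by simp
  next
    case False
    then have pos: "0 < prob ?A" by (simp add: zero_less_measure_iff)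
    have "uniform_measure M ?A = density M (\<lambda>x. ennreal (indicator ?A x / prob ?A))"
      unfolding uniform_measure_def using pos
      by (intro density_cong)
         (auto intro!: AE_I2 simp: emeasure_eq_measure divide_ennreal ennreal_1[symmetric]
            simp del: ennreal_1 split: split_indicator)
    then have "cond_expectation M g Q = (\<integral>x. (indicator ?A x / prob ?A) *\<^sub>R g x \<partial>M)"
      unfolding cond_expectation_def using A pos by (subst integral_density[symmetric]) auto
    also have "\<dots> = (\<integral>x. indicator ?A x * g x \<partial>M) / prob ?A"
      by (simp add: times_divide_eq_left)
    finally show ?thesis using pos by simp
  qed
qed

text \<open>
  Jumps of size at least \<open>U\<close> are charged the whole potential. Concavity of
  \<^const>\<open>saturation\<close> bounds it below on \<open>[0, a]\<close> by the chord through the origin, and for this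
  linear function the expected decrease is at most \<open>1\<close>.
\<close>

lemma (in prob_space) saturation_drift:
  assumes S[measurable]: "S \<in> borel_measurable M" and d[measurable]: "d \<in> borel_measurable M"
    and S_nonneg: "\<And>y. y \<in> space M \<Longrightarrow> 0 \<le> S y"
    and a: "0 \<le> a" and S_le: "AE y in M. S y \<le> a"
    and d_nonneg: "AE y in M. 0 \<le> d y"
    and small: "AE y in M. d y < U \<longrightarrow> a - S y \<le> d y / m"
    and large: "\<P>(y in M. U \<le> d y) \<le> \<epsilon>" and "\<epsilon> \<le> 1"
    and m: "0 < m" "cond_expectation M d (\<lambda>y. d y < U) \<le> m"
  shows "saturation \<epsilon> a \<le> (\<integral>y. saturation \<epsilon> (S y) \<partial>M) + 1"
proof -
  let ?A = "{y \<in> space M. d y < U}"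
  define D where "D = \<epsilon> * a + (1 - \<epsilon>)"
  have A[measurable]: "?A \<in> events" by measurable
  have \<epsilon>: "0 \<le> \<epsilon>" using large measure_nonneg order_trans by blast
  have H_nonneg: "y \<in> space M \<Longrightarrow> 0 \<le> saturation \<epsilon> (S y)" for y
    using \<epsilon> \<open>\<epsilon> \<le> 1\<close> S_nonneg by (intro saturation_nonneg)
  show ?thesis
  proof (cases "a \<le> 1")
    \<comment> \<open>Here the summand \<open>1\<close> alone pays for the whole of
      \<open>saturation \<epsilon> a\<close>.\<close>
    case True
    then have "saturation \<epsilon> a \<le> 1"
      using \<epsilon> \<open>\<epsilon> \<le> 1\<close> a by (intro saturation_le_1)
    moreover have "0 \<le> (\<integral>y. saturation \<epsilon> (S y) \<partial>M)"
      using H_nonneg by (intro integral_nonneg_AE AE_I2)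
    ultimately show ?thesis by simp
  next
    case False
    have D: "0 < D"
      unfolding D_def using False \<epsilon> \<open>\<epsilon> \<le> 1\<close> by (intro saturation_denominator_pos) auto
    have "prob ?A = 1 - \<P>(y in M. U \<le> d y)"
      by (subst prob_neg[symmetric]) (auto simp: not_le)
    with large have pA: "1 - \<epsilon> \<le> prob ?A" by simp
    have int_d: "integrable M (\<lambda>y. indicator ?A y * d y)"
    proof (rule integrable_const_bound)
      show "AE y in M. norm (indicator ?A y * d y) \<le> \<bar>U\<bar>"
        using d_nonneg by eventually_elim (auto split: split_indicator)
    qed measurable
    have int_a: "integrable M (\<lambda>y. indicator ?A y * a)"
      by (rule integrable_const_bound[of _ "\<bar>a\<bar>"]) (auto split: split_indicator)
    have int_H: "integrable M (\<lambda>y. saturation \<epsilon> (S y))"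
    proof (rule integrable_const_bound)
      show "AE y in M. norm (saturation \<epsilon> (S y)) \<le> 1 + a"
        using S_le AE_space
      proof eventually_elim
        fix y assume "S y \<le> a" "y \<in> space M"
        with H_nonneg[of y] saturation_le[OF \<epsilon> \<open>\<epsilon> \<le> 1\<close> S_nonneg[of y]]
        show "norm (saturation \<epsilon> (S y)) \<le> 1 + a" by simp
      qed
    qed measurable
    have int_d_le: "(\<integral>y. indicator ?A y * d y \<partial>M) \<le> prob ?A * m"
      using mult_right_mono[OF m(2), of "prob ?A"] cond_expectation_mult_prob[of d "\<lambda>y. d y < U"]
      by (simp add: mult.commute)
    \<comment> \<open>The chain first lowers the target to an integral over small steps. The factor
      \<open>1 - \<epsilon>\<close> may be replaced by \<open>prob ?A\<close> because
      \<open>a > 1\<close>, and \<open>prob ?A\<close> is at least the integral of \<open>d\<close>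
      over \<open>?A\<close> divided by \<open>m\<close>.\<close>
    have "saturation \<epsilon> a - 1 = (a - D) / D"
      using D by (simp add: saturation_def D_def[symmetric] diff_divide_distrib)
    also have "a - D = (1 - \<epsilon>) * (a - 1)"
      by (simp add: D_def algebra_simps)
    also have "(1 - \<epsilon>) * (a - 1) / D \<le> prob ?A * (a - 1) / D"
      using D pA False by (intro divide_right_mono mult_right_mono) auto
    also have "\<dots> \<le> (prob ?A * a - (\<integral>y. indicator ?A y * d y \<partial>M) / m) / D"
      using D int_d_le \<open>0 < m\<close> by (intro divide_right_mono) (auto simp: field_simps)
    also have "\<dots> = (\<integral>y. (indicator ?A y * a - indicator ?A y * d y / m) / D \<partial>M)"
      using int_a int_d by simp
    also have "\<dots> \<le> (\<integral>y. saturation \<epsilon> (S y) \<partial>M)"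
    proof (rule integral_mono_AE)
      show "AE y in M. (indicator ?A y * a - indicator ?A y * d y / m) / D \<le> saturation \<epsilon> (S y)"
        using S_le small AE_space
      proof eventually_elim
        fix y assume y: "S y \<le> a" "d y < U \<longrightarrow> a - S y \<le> d y / m" "y \<in> space M"
        show "(indicator ?A y * a - indicator ?A y * d y / m) / D \<le> saturation \<epsilon> (S y)"
        \<comment> \<open>On small steps the left side is at most the chord at \<open>S y\<close>.
          On large steps it is \<open>0\<close>, which is how they forfeit the entire
          potential.\<close>
        proof (cases "y \<in> ?A")
          case True
          with y have "(a - d y / m) / D \<le> S y / D"
            using D by (intro divide_right_mono) auto
          also have "\<dots> \<le> saturation \<epsilon> (S y)"
            unfolding D_def using \<epsilon> \<open>\<epsilon> \<le> 1\<close> y S_nonneg by (intro saturation_ge_chord)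
          finally show ?thesis using True by simp
        qed (use H_nonneg y in simp)
      qed
    qed (use int_a int_d int_H in auto)
    finally show ?thesis by simp
  qed
qed

section \<open>Summation of the decreases along the process\<close>

text \<open>The potential \<open>S\<close> is abstract here. Telescoping the saturated potential
  leaves a sum of the probabilities that zero has not been reached, at most the expected hitting
  time, plus a remainder at time \<open>n\<close>. The bound \<open>C\<close> is what lets the
  remainder vanish.\<close>

lemma (in markov_process) expected_hitting_time_zero_ge_saturation:
  fixes f S \<mu> :: "'b \<Rightarrow> real"
  assumes X0: "\<And>\<omega>. \<omega> \<in> space P \<Longrightarrow> X 0 \<omega> = x0"
    and f[measurable]: "f \<in> borel_measurable M"
    and f_nonneg: "\<And>x. x \<in> space M \<Longrightarrow> f x \<ge> 0"
    and dec: "\<And>t. AE \<omega> in P. \<P>(y in K t (X t \<omega>). f (X t \<omega>) - f y \<ge> 0) = 1"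
    and \<epsilon>: "0 \<le> \<epsilon>" "\<epsilon> \<le> 1"
    and large: "\<And>t x. x \<in> space M \<Longrightarrow> f x > 0 \<Longrightarrow> \<P>(y in K t x. f x - f y \<ge> U) \<le> \<epsilon>"
    and \<mu>_pos: "\<And>x. x \<in> space M \<Longrightarrow> f x > 0 \<Longrightarrow> \<mu> x > 0"
    and drift: "\<And>t x. x \<in> space M \<Longrightarrow> f x > 0 \<Longrightarrow>
           \<mu> x \<ge> cond_expectation (K t x) (\<lambda>y. f x - f y) (\<lambda>y. f x - f y < U)"
    and S[measurable]: "S \<in> borel_measurable M"
    and S_nonneg: "\<And>x. x \<in> space M \<Longrightarrow> 0 \<le> S x"
    and S_le: "\<And>x. x \<in> space M \<Longrightarrow> S x \<le> C"
    and S_zero: "\<And>x. x \<in> space M \<Longrightarrow> f x = 0 \<Longrightarrow> S x = 0"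
    and S_mono: "\<And>x y. x \<in> space M \<Longrightarrow> y \<in> space M \<Longrightarrow> f y \<le> f x \<Longrightarrow> S y \<le> S x"
    and S_diff: "\<And>x y. x \<in> space M \<Longrightarrow> y \<in> space M \<Longrightarrow> f x > 0 \<Longrightarrow> f y \<le> f x \<Longrightarrow>
           f x - f y < U \<Longrightarrow> S x - S y \<le> (f x - f y) / \<mu> x"
  shows "ennreal (saturation \<epsilon> (S x0)) \<le> (\<integral>\<^sup>+\<omega>. ennreal_of_enat (hitting_time_zero f X \<omega>) \<partial>P)"
    (is "_ \<le> ?E")
proof -
  note [measurable] = random_variable_X
  define H where "H x = saturation \<epsilon> (S x)" for x
  have [measurable]: "H \<in> borel_measurable M" unfolding H_def by measurable
  have H_nonneg: "0 \<le> H x" if "x \<in> space M" for x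
    unfolding H_def using \<epsilon> S_nonneg that by (intro saturation_nonneg)
  have H_le: "H x \<le> 1 + C" if "x \<in> space M" for x
    unfolding H_def using saturation_le[OF \<epsilon> S_nonneg[OF that]] S_le[OF that] by simp
  define p where "p t = emeasure P {\<omega> \<in> space P. f (X t \<omega>) \<noteq> 0}" for t
  \<comment> \<open>A state with \<open>f x = 0\<close> has \<open>H x = 0\<close>, so the cost
    \<open>1\<close> of a step is charged only on the event of probability \<open>p t\<close>. In
    every other state \<open>saturation_drift\<close> is applied to the law
    \<open>K t x\<close>.\<close>
  have step: "(\<integral>\<^sup>+\<omega>. H (X t \<omega>) \<partial>P) \<le> (\<integral>\<^sup>+\<omega>. H (X (Suc t) \<omega>) \<partial>P) + p t" for t
  proof -
    let ?I = "indicator {\<omega> \<in> space P. f (X t \<omega>) \<noteq> 0}"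
    have "(\<integral>\<^sup>+\<omega>. H (X t \<omega>) \<partial>P) \<le> (\<integral>\<^sup>+\<omega>. (\<integral>\<^sup>+y. H y \<partial>K t (X t \<omega>)) + ?I \<omega> \<partial>P)"
    proof (rule nn_integral_mono_AE, use dec[of t] AE_space in eventually_elim)
      fix \<omega> assume one: "\<P>(y in K t (X t \<omega>). f (X t \<omega>) - f y \<ge> 0) = 1" and \<omega>: "\<omega> \<in> space P"
      define x where "x = X t \<omega>"
      have x: "x \<in> space M" unfolding x_def using \<omega> by (rule X_in_space)
      interpret N: prob_space "K t x" by (rule prob_space_kernel[OF x])
      note sets_K[OF x, measurable_cong]
      have sp: "space (K t x) = space M" using sets_K[OF x] by (rule sets_eq_imp_space_eq)
      show "ennreal (H (X t \<omega>)) \<le> (\<integral>\<^sup>+y. H y \<partial>K t (X t \<omega>)) + ?I \<omega>"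
      proof (cases "f x = 0")
        case True
        with x show ?thesis by (simp add: H_def S_zero flip: x_def)
      next
        case False
        with f_nonneg[OF x] have fx: "0 < f x" by simp
        have dec_x: "AE y in K t x. 0 \<le> f x - f y"
          using one unfolding x_def[symmetric] by (subst (asm) N.prob_Collect_eq_1) auto
        have "saturation \<epsilon> (S x) \<le> (\<integral>y. saturation \<epsilon> (S y) \<partial>K t x) + 1"
        proof (rule N.saturation_drift[where d = "\<lambda>y. f x - f y" and U = U and m = "\<mu> x"])
          show "AE y in K t x. S y \<le> S x"
            using dec_x AE_space by eventually_elim (use x sp S_mono in auto)
          show "AE y in K t x. f x - f y < U \<longrightarrow> S x - S y \<le> (f x - f y) / \<mu> x"
            using dec_x AE_space by eventually_elim (use x sp S_diff fx in auto)
        qed (use dec_x S_nonneg sp \<epsilon> x fx large[OF x fx, of t] \<mu>_pos drift in auto)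
        moreover have "integrable (K t x) H"
          by (rule N.integrable_const_bound[of _ "1 + C"])
             (auto intro!: AE_I2 simp: sp H_nonneg H_le)
        then have "(\<integral>\<^sup>+y. H y \<partial>K t x) = ennreal (\<integral>y. H y \<partial>K t x)"
          by (rule nn_integral_eq_integral) (auto intro!: AE_I2 simp: sp H_nonneg)
        moreover have "0 \<le> (\<integral>y. H y \<partial>K t x)"
          by (intro integral_nonneg_AE AE_I2) (simp add: sp H_nonneg)
        ultimately have "ennreal (H x) \<le> (\<integral>\<^sup>+y. H y \<partial>K t x) + 1"
          by (simp add: H_def ennreal_plus[symmetric] ennreal_1[symmetric] del: ennreal_plus ennreal_1)
        with False \<omega> show ?thesis by (simp add: x_def)
      qed
    qed
    also have "\<dots> = (\<integral>\<^sup>+\<omega>. (\<integral>\<^sup>+y. H y \<partial>K t (X t \<omega>)) \<partial>P) + (\<integral>\<^sup>+\<omega>. ?I \<omega> \<partial>P)"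
    proof (rule nn_integral_add)
      show "(\<lambda>\<omega>. \<integral>\<^sup>+y. H y \<partial>K t (X t \<omega>)) \<in> borel_measurable P"
        by (rule measurable_compose[OF random_variable_X measurable_compose[OF kernel_subprob
              nn_integral_measurable_subprob_algebra]]) measurable
    qed measurable
    also have "\<dots> = (\<integral>\<^sup>+\<omega>. H (X (Suc t) \<omega>) \<partial>P) + p t"
      using nn_integral_next[of "\<lambda>x. ennreal (H x)" t] by (simp add: p_def)
    finally show ?thesis .
  qed
  have telescope: "ennreal (H x0) \<le> (\<integral>\<^sup>+\<omega>. H (X n \<omega>) \<partial>P) + (\<Sum>t<n. p t)" for n
  proof (induction n)
    case 0
    have "(\<integral>\<^sup>+\<omega>. H (X 0 \<omega>) \<partial>P) = (\<integral>\<^sup>+\<omega>. H x0 \<partial>P)"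
      by (intro nn_integral_cong) (simp add: X0)
    then show ?case by (simp add: emeasure_space_1)
  next
    case (Suc n)
    also note add_right_mono[OF step[of n]]
    finally show ?case by (simp add: add_ac)
  qed
  \<comment> \<open>\<open>H\<close> vanishes where \<open>f\<close> does and is at most
    \<open>1 + C\<close> elsewhere.\<close>
  have remainder: "(\<integral>\<^sup>+\<omega>. H (X n \<omega>) \<partial>P) \<le> ennreal (1 + C) * p n" for n
  proof -
    have "(\<integral>\<^sup>+\<omega>. H (X n \<omega>) \<partial>P) \<le> (\<integral>\<^sup>+\<omega>. ennreal (1 + C) * indicator {\<omega> \<in> space P. f (X n \<omega>) \<noteq> 0} \<omega> \<partial>P)"
    proof (intro nn_integral_mono)
      fix \<omega> assume \<omega>: "\<omega> \<in> space P"
      with S_zero[of "X n \<omega>"] H_le[of "X n \<omega>"] X_in_space[of \<omega> n]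
      show "ennreal (H (X n \<omega>)) \<le> ennreal (1 + C) * indicator {\<omega> \<in> space P. f (X n \<omega>) \<noteq> 0} \<omega>"
        by (auto simp: H_def ennreal_leI split: split_indicator)
    qed
    then show ?thesis by (simp add: nn_integral_cmult p_def)
  qed
  have absorbing: "AE \<omega> in P. \<forall>t. f (X t \<omega>) = 0 \<longrightarrow> f (X (Suc t) \<omega>) = 0"
    unfolding AE_all_countable using AE_zero_absorbing[OF f f_nonneg dec] by blast
  have sum_le: "(\<Sum>t<n. p t) \<le> ?E" for n
  proof -
    have "(\<Sum>t<n. p t) = (\<integral>\<^sup>+\<omega>. (\<Sum>t<n. indicator {\<omega> \<in> space P. f (X t \<omega>) \<noteq> 0} \<omega>) \<partial>P)"
      by (subst nn_integral_sum) (auto simp: p_def)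
    also have "\<dots> \<le> ?E"
    proof (rule nn_integral_mono_AE, use absorbing AE_space in eventually_elim)
      fix \<omega> assume "\<forall>t. f (X t \<omega>) = 0 \<longrightarrow> f (X (Suc t) \<omega>) = 0" "\<omega> \<in> space P"
      with hitting_time_zero_ge[of f X \<omega> n]
      show "(\<Sum>t<n. indicator {\<omega> \<in> space P. f (X t \<omega>) \<noteq> 0} \<omega>) \<le> ennreal_of_enat (hitting_time_zero f X \<omega>)"
        by (simp add: indicator_def)
    qed
    finally show ?thesis .
  qed
  show ?thesis
  proof (cases "?E = top")
    case False
    \<comment> \<open>A finite expected hitting time makes the \<open>p t\<close> summable, so they
      tend to \<open>0\<close> and take the remainder with them.\<close>
    have "(\<Sum>t. p t) \<le> ?E"
      unfolding suminf_eq_SUP using sum_le by (intro SUP_least)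
    with False have "(\<Sum>t. p t) \<noteq> top" by (auto simp: top_unique)
    then have "summable (\<lambda>t. prob {\<omega> \<in> space P. f (X t \<omega>) \<noteq> 0})"
      unfolding p_def emeasure_eq_measure by (intro summable_suminf_not_top) auto
    then have "p \<longlonglongrightarrow> ennreal 0"
      unfolding p_def emeasure_eq_measure by (intro tendsto_ennrealI summable_LIMSEQ_zero)
    then have "p \<longlonglongrightarrow> 0" by simp
    then have "(\<lambda>n. ennreal (1 + C) * p n + ?E) \<longlonglongrightarrow> ennreal (1 + C) * 0 + ?E"
      by (intro tendsto_add ennreal_tendsto_cmult tendsto_const) simp_all
    moreover have "ennreal (H x0) \<le> ennreal (1 + C) * p n + ?E" for n
      using telescope[of n] add_mono[OF remainder[of n] sum_le[of n]] by (rule order_trans)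
    ultimately have "ennreal (H x0) \<le> ennreal (1 + C) * 0 + ?E"
      by (intro LIMSEQ_le_const) auto
    then show ?thesis by (simp add: H_def)
  qed simp
qed

section \<open>Potentials given by an integrable density\<close>

lemma inverse_antimono_ennreal:
  fixes a b :: ennreal
  shows "a \<le> b \<Longrightarrow> inverse b \<le> inverse a"
  including ennreal.lifting by transfer (auto intro: ereal_inverse_antimono)

lemma set_lebesgue_integral_Icc_diff:
  fixes \<phi> :: "real \<Rightarrow> real"
  assumes \<phi>: "integrable lborel \<phi>" and uv: "u \<le> v" "0 \<le> u"
  shows "(LINT z:{0..v}|lborel. \<phi> z) - (LINT z:{0..u}|lborel. \<phi> z) = (LINT z:{u<..v}|lborel. \<phi> z)"
proof -
  have int: "set_integrable lborel A \<phi>" if "A \<in> sets borel" for A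
    unfolding set_integrable_def using \<phi> that by (intro integrable_mult_indicator) auto
  have "{0..v} = {0..u} \<union> {u<..v}" using uv by auto
  then have "(LINT z:{0..v}|lborel. \<phi> z) = (LINT z:{0..u} \<union> {u<..v}|lborel. \<phi> z)" by simp
  also have "\<dots> = (LINT z:{0..u}|lborel. \<phi> z) + (LINT z:{u<..v}|lborel. \<phi> z)"
    by (rule set_integral_Un) (auto intro: int)
  finally show ?thesis by simp
qed

text \<open>The abstract potential becomes the integral of \<open>\<phi>\<close> from
  \<open>0\<close> to \<open>f x\<close>. Integrability of \<open>\<phi>\<close> supplies its bound,
  nonnegativity its monotonicity, and the bound on \<open>\<phi>\<close> over windows of length
  \<open>U\<close> its control over small steps.\<close>

lemma (in markov_process) expected_hitting_time_zero_ge_density: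
  fixes f \<mu> :: "'b \<Rightarrow> real" and \<phi> :: "real \<Rightarrow> real"
  assumes X0: "\<And>\<omega>. \<omega> \<in> space P \<Longrightarrow> X 0 \<omega> = x0"
    and f[measurable]: "f \<in> borel_measurable M"
    and f_nonneg: "\<And>x. x \<in> space M \<Longrightarrow> f x \<ge> 0"
    and dec: "\<And>t. AE \<omega> in P. \<P>(y in K t (X t \<omega>). f (X t \<omega>) - f y \<ge> 0) = 1"
    and \<epsilon>: "0 \<le> \<epsilon>" "\<epsilon> \<le> 1"
    and large: "\<And>t x. x \<in> space M \<Longrightarrow> f x > 0 \<Longrightarrow> \<P>(y in K t x. f x - f y \<ge> U) \<le> \<epsilon>"
    and \<mu>_pos: "\<And>x. x \<in> space M \<Longrightarrow> f x > 0 \<Longrightarrow> \<mu> x > 0"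
    and drift: "\<And>t x. x \<in> space M \<Longrightarrow> f x > 0 \<Longrightarrow>
           \<mu> x \<ge> cond_expectation (K t x) (\<lambda>y. f x - f y) (\<lambda>y. f x - f y < U)"
    and \<phi>: "integrable lborel \<phi>" and \<phi>_nonneg: "\<And>z. 0 \<le> \<phi> z"
    and \<phi>_le: "\<And>x z. x \<in> space M \<Longrightarrow> f x > 0 \<Longrightarrow> f x \<in> {z..<z + U} \<Longrightarrow> \<phi> z \<le> 1 / \<mu> x"
  shows "ennreal (saturation \<epsilon> (LINT z:{0..f x0}|lborel. \<phi> z))
         \<le> (\<integral>\<^sup>+\<omega>. ennreal_of_enat (hitting_time_zero f X \<omega>) \<partial>P)"
proof -
  define \<Phi> where "\<Phi> w = (LINT z:{0..w}|lborel. \<phi> z)" for w :: real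
  have int: "set_integrable lborel A \<phi>" if "A \<in> sets borel" for A
    unfolding set_integrable_def using \<phi> that by (intro integrable_mult_indicator) auto
  have \<Phi>_mono: "mono \<Phi>"
    unfolding \<Phi>_def set_lebesgue_integral_def
    by (intro monoI integral_mono int[unfolded set_integrable_def])
       (auto simp: \<phi>_nonneg split: split_indicator)
  have [measurable]: "\<Phi> \<in> borel_measurable borel"
    using \<Phi>_mono by (rule borel_measurable_mono)
  show ?thesis
    unfolding \<Phi>_def[symmetric]
  proof (rule expected_hitting_time_zero_ge_saturation[where S = "\<lambda>x. \<Phi> (f x)" and C = "integral\<^sup>L lborel \<phi>"
        and U = U and \<mu> = \<mu>, OF X0 f f_nonneg dec \<epsilon> large \<mu>_pos drift])
    fix x show "0 \<le> \<Phi> (f x)"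
      unfolding \<Phi>_def set_lebesgue_integral_def by (simp add: \<phi>_nonneg)
    show "\<Phi> (f x) \<le> integral\<^sup>L lborel \<phi>"
      unfolding \<Phi>_def set_lebesgue_integral_def
      by (intro integral_mono int[unfolded set_integrable_def] \<phi>)
         (auto simp: \<phi>_nonneg split: split_indicator)
    assume "f x = 0"
    then show "\<Phi> (f x) = 0"
      unfolding \<Phi>_def set_lebesgue_integral_def
      by (intro integral_eq_zero_AE eventually_mono[OF AE_lborel_singleton[of 0]]) auto
  next
    fix x y assume xy: "x \<in> space M" "y \<in> space M" "0 < f x" "f y \<le> f x" "f x - f y < U"
    have "\<Phi> (f x) - \<Phi> (f y) = (LINT z:{f y<..f x}|lborel. \<phi> z)"
      unfolding \<Phi>_def using xy f_nonneg by (intro set_lebesgue_integral_Icc_diff \<phi>) auto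
    \<comment> \<open>A crossed level satisfies \<open>f y < z\<close> and
      \<open>z \<le> f x\<close>. Together with \<open>f x - f y < U\<close> this puts
      \<open>f x\<close> into \<open>{z..<z + U}\<close>, so \<open>\<phi> z\<close> is at most
      \<open>1 / \<mu> x\<close>.\<close>
    also have "\<dots> \<le> (LINT z:{f y<..f x}|lborel. 1 / \<mu> x)"
      using xy by (intro set_integral_mono int \<phi>_le) (auto simp: set_integrable_def)
    also have "\<dots> = (f x - f y) / \<mu> x"
      using xy by (simp add: set_lebesgue_integral_def)
    finally show "\<Phi> (f x) - \<Phi> (f y) \<le> (f x - f y) / \<mu> x" .
  qed (auto intro: monoD[OF \<Phi>_mono])
qed

section \<open>From simple functions to the potential\<close>

theorem theorem1:
  fixes P :: "'a measure" and M :: "'b measure"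
    and X :: "nat \<Rightarrow> 'a \<Rightarrow> 'b" and K :: "nat \<Rightarrow> 'b \<Rightarrow> 'b measure"
    and x0 :: 'b and f :: "'b \<Rightarrow> real" and \<mu> :: "'b \<Rightarrow> real" and U \<epsilon> :: real
  defines "T \<equiv> drift_potential M f U \<mu> x0"
  assumes "markov_process P M X K"
    and "\<And>\<omega>. \<omega> \<in> space P \<Longrightarrow> X 0 \<omega> = x0"
    and "f \<in> borel_measurable M"
    and "\<And>x. x \<in> space M \<Longrightarrow> f x \<ge> 0"
    and "\<And>t. AE \<omega> in P. \<P>(y in K t (X t \<omega>). f (X t \<omega>) - f y \<ge> 0) = 1"
    and "\<epsilon> \<le> 1"
    and "\<And>t x. x \<in> space M \<Longrightarrow> f x > 0 \<Longrightarrow> \<P>(y in K t x. f x - f y \<ge> U) \<le> \<epsilon>"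
    and "\<And>x. x \<in> space M \<Longrightarrow> f x > 0 \<Longrightarrow> \<mu> x > 0"
    and "\<And>t x. x \<in> space M \<Longrightarrow> f x > 0 \<Longrightarrow>
           \<mu> x \<ge> cond_expectation (K t x) (\<lambda>y. f x - f y) (\<lambda>y. f x - f y < U)"
  shows "(\<integral>\<^sup>+ \<omega>. ennreal_of_enat (hitting_time_zero f X \<omega>) \<partial>P) \<ge>
           (if T = \<infinity> then 1 / ennreal \<epsilon> else T / (ennreal \<epsilon> * T + ennreal (1 - \<epsilon>)))"
proof -
  interpret markov_process P M X K by fact
  define E where "E = (\<integral>\<^sup>+ \<omega>. ennreal_of_enat (hitting_time_zero f X \<omega>) \<partial>P)"
  define F where "F z = 1 / drift_sup M f U \<mu> z * indicator {0..f x0} z" for z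
  have T_eq: "T = (\<integral>\<^sup>+z. F z \<partial>lborel)"
    unfolding T_def drift_potential_def F_def ..
  obtain \<omega>0 where "\<omega>0 \<in> space P" using not_empty by auto
  then have x0: "x0 \<in> space M" using X_in_space[of \<omega>0 0] assms(3) by simp
  show ?thesis
  \<comment> \<open>If \<open>f x0 = 0\<close>, the integral runs over a single point and
    \<open>T = 0\<close>. Otherwise the jump bound at \<open>x0\<close> itself yields
    \<open>0 \<le> \<epsilon>\<close>.\<close>
  proof (cases "f x0 = 0")
    case True
    have "T = (\<integral>\<^sup>+(z::real). 0 \<partial>lborel)"
      unfolding T_eq F_def
      by (rule nn_integral_cong_AE, rule eventually_mono[OF AE_lborel_singleton[of 0]])
         (simp add: True)
    then show ?thesis by simp
  next
    case False
    with assms(5)[OF x0] have "0 < f x0" by simp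
    then have \<epsilon>: "0 \<le> \<epsilon>"
      using assms(8)[OF x0] measure_nonneg order_trans by blast
    let ?G = "{g. simple_function lborel g \<and> g \<le> F \<and> (\<forall>z. g z < top)}"
    \<comment> \<open>The nonnegative integral is this supremum for an arbitrary integrand, so
      \<open>F\<close> may be nonmeasurable. Finite values of \<open>g\<close> allow real arithmetic
      even where \<open>F\<close> is infinite.\<close>
    have T_SUP: "T = (SUP g\<in>?G. integral\<^sup>S lborel g)"
      unfolding T_eq by (rule nn_integral_def_finite)
    have bound: "\<exists>a\<ge>0. integral\<^sup>S lborel g = ennreal a \<and> ennreal (saturation \<epsilon> a) \<le> E"
      if g: "g \<in> ?G" for g
    proof -
      define \<phi> where "\<phi> z = enn2real (g z)" for z
      have \<phi>_eq: "ennreal (\<phi> z) = g z" for z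
        using g by (simp add: \<phi>_def)
      have supp: "g z = 0" if "z \<notin> {0..f x0}" for z
        using g that by (auto simp: le_fun_def F_def dest!: spec[of _ z])
      have [measurable]: "g \<in> borel_measurable borel"
        using g borel_measurable_simple_function[of lborel g] by simp
      \<comment> \<open>\<open>g\<close> is supported on \<open>{0..f x0}\<close> and bounded by its
        largest value \<open>B\<close>, so its integral is at most \<open>B\<close> times the length
        of the interval.\<close>
      have "finite (range g)" using g by (simp add: simple_function_def)
      define B where "B = Max (range g)"
      have "B \<in> range g" unfolding B_def using \<open>finite (range g)\<close> by (intro Max_in) auto
      with g have "B < top" by auto
      have "(\<integral>\<^sup>+z. g z \<partial>lborel) \<le> (\<integral>\<^sup>+z. B * indicator {0..f x0} z \<partial>lborel)"
        using \<open>finite (range g)\<close> supp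
        by (intro nn_integral_mono) (auto simp: B_def split: split_indicator)
      also have "\<dots> = B * ennreal (f x0)"
        using \<open>0 < f x0\<close> by (simp add: nn_integral_cmult)
      also have "\<dots> < top" using \<open>B < top\<close> by (simp add: ennreal_mult_less_top)
      finally have fin: "(\<integral>\<^sup>+z. ennreal (\<phi> z) \<partial>lborel) < \<infinity>" by (simp add: \<phi>_eq)
      have \<phi>_int: "integrable lborel \<phi>"
        unfolding \<phi>_def[abs_def] by (rule integrableI_nonneg) (use fin in \<open>auto simp: \<phi>_def\<close>)
      have \<phi>_le: "\<phi> z \<le> 1 / \<mu> x" if x: "x \<in> space M" "f x > 0" "f x \<in> {z..<z + U}" for x z
      proof -
        have "\<mu> x > 0" using assms(9) x by simp
        have "ennreal (\<mu> x) \<le> drift_sup M f U \<mu> z"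
          unfolding drift_sup_def using x by (intro SUP_upper) auto
        then have "1 / drift_sup M f U \<mu> z \<le> 1 / ennreal (\<mu> x)"
          by (simp add: divide_ennreal_def inverse_antimono_ennreal)
        then have "F z \<le> 1 / ennreal (\<mu> x)"
          by (auto simp: F_def split: split_indicator)
        with g have "g z \<le> 1 / ennreal (\<mu> x)"
          by (auto simp: le_fun_def intro: order_trans)
        also have "\<dots> = ennreal (1 / \<mu> x)"
          using \<open>\<mu> x > 0\<close> divide_ennreal[of 1 "\<mu> x"] by simp
        finally show ?thesis
          using \<open>\<mu> x > 0\<close> unfolding \<phi>_eq[symmetric] by (subst (asm) ennreal_le_iff) auto
      qed
      have "(LINT z:{0..f x0}|lborel. \<phi> z) = integral\<^sup>L lborel \<phi>"
        unfolding set_lebesgue_integral_def using supp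
        by (intro Bochner_Integration.integral_cong) (auto simp: \<phi>_def split: split_indicator)
      then have "ennreal (saturation \<epsilon> (integral\<^sup>L lborel \<phi>)) \<le> E"
        unfolding E_def
        using expected_hitting_time_zero_ge_density[where U = U and \<mu> = \<mu>,
            OF assms(3-6) \<epsilon> assms(7-10) \<phi>_int _ \<phi>_le]
        by (simp add: \<phi>_def)
      moreover have "integral\<^sup>S lborel g = ennreal (integral\<^sup>L lborel \<phi>)"
      proof -
        have "integral\<^sup>S lborel g = (\<integral>\<^sup>+z. g z \<partial>lborel)"
          using g by (intro nn_integral_eq_simple_integral[symmetric]) auto
        also have "\<dots> = ennreal (integral\<^sup>L lborel \<phi>)"
          unfolding \<phi>_eq[symmetric] by (rule nn_integral_eq_integral[OF \<phi>_int]) (simp add: \<phi>_def)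
        finally show ?thesis .
      qed
      moreover have "0 \<le> integral\<^sup>L lborel \<phi>" by (simp add: \<phi>_def)
      ultimately show ?thesis by blast
    qed
    show ?thesis
    proof (cases E)
      case top
      then show ?thesis by (simp add: E_def)
    next
      case (real r)
      \<comment> \<open>Cleared of the division, the bound is affine in \<open>a\<close>, which
        makes the passage to the supremum easy. The case \<open>a = 0\<close> is separate because
        the denominator may then be zero.\<close>
      have le: "\<exists>a\<ge>0. integral\<^sup>S lborel g = ennreal a \<and> a \<le> r * (\<epsilon> * a + (1 - \<epsilon>))" if g: "g \<in> ?G" for g
      proof -
        obtain a where a: "a \<ge> 0" "integral\<^sup>S lborel g = ennreal a" "ennreal (saturation \<epsilon> a) \<le> E"
          using bound[OF g] by blast
        then have "saturation \<epsilon> a \<le> r" using real by simp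
        then have "a \<le> r * (\<epsilon> * a + (1 - \<epsilon>))"
          using a(1) \<open>r \<ge> 0\<close> \<epsilon> assms(7) saturation_denominator_pos[of \<epsilon> a]
          by (cases "a = 0") (auto simp: saturation_def pos_divide_le_eq)
        with a show ?thesis by blast
      qed
      show ?thesis
      proof (cases T)
        case top
        have "1 \<le> \<epsilon> * r"
        \<comment> \<open>If \<open>\<epsilon> * r < 1\<close>, solving the affine inequality for
          \<open>a\<close> bounds all simple integrals by one finite constant, contradicting
          \<open>T = \<infinity>\<close>.\<close>
        proof (rule ccontr)
          assume "\<not> 1 \<le> \<epsilon> * r"
          then have pos: "0 < 1 - \<epsilon> * r" by simp
          have "T \<le> ennreal (r * (1 - \<epsilon>) / (1 - \<epsilon> * r))"
            unfolding T_SUP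
          proof (rule SUP_least)
            fix g assume "g \<in> ?G"
            from le[OF this] obtain a where "integral\<^sup>S lborel g = ennreal a"
              "a \<le> r * (\<epsilon> * a + (1 - \<epsilon>))" by blast
            moreover from this(2) have "a \<le> r * (1 - \<epsilon>) / (1 - \<epsilon> * r)"
              using pos by (simp add: pos_le_divide_eq algebra_simps)
            ultimately show "integral\<^sup>S lborel g \<le> ennreal (r * (1 - \<epsilon>) / (1 - \<epsilon> * r))"
              by (simp add: ennreal_leI)
          qed
          with top show False by (simp add: top_unique)
        qed
        then have "\<epsilon> \<noteq> 0" by auto
        with \<epsilon> have "0 < \<epsilon>" by simp
        have "1 / ennreal \<epsilon> = ennreal (1 / \<epsilon>)"
          using divide_ennreal[of 1 \<epsilon>] \<open>0 < \<epsilon>\<close> by simp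
        also have "\<dots> \<le> ennreal r"
          using \<open>1 \<le> \<epsilon> * r\<close> \<open>0 < \<epsilon>\<close> by (intro ennreal_leI) (simp add: field_simps)
        finally show ?thesis using top real by (simp add: E_def)
      next
        case (real s)
        have D: "0 \<le> \<epsilon> * s + (1 - \<epsilon>)" using \<epsilon> \<open>s \<ge> 0\<close> assms(7) by simp
        \<comment> \<open>Each simple integral \<open>a\<close> is at most \<open>s\<close>, and the
          affine right side is nondecreasing in \<open>a\<close>. Replacing \<open>a\<close> by
          \<open>s\<close> there gives a bound common to all of them.\<close>
        have "T \<le> ennreal (r * (\<epsilon> * s + (1 - \<epsilon>)))"
          unfolding T_SUP
        proof (rule SUP_least)
          fix g assume g: "g \<in> ?G"
          from le[OF this] obtain a where a: "integral\<^sup>S lborel g = ennreal a"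
            "a \<le> r * (\<epsilon> * a + (1 - \<epsilon>))" by blast
          have "integral\<^sup>S lborel g \<le> T" unfolding T_SUP using g by (rule SUP_upper)
          with a real have "a \<le> s" by (simp add: ennreal_le_iff)
          then have "r * (\<epsilon> * a + (1 - \<epsilon>)) \<le> r * (\<epsilon> * s + (1 - \<epsilon>))"
            using \<open>r \<ge> 0\<close> \<epsilon> by (intro mult_left_mono add_right_mono) auto
          with a show "integral\<^sup>S lborel g \<le> ennreal (r * (\<epsilon> * s + (1 - \<epsilon>)))"
            by (simp add: ennreal_leI)
        qed
        then have s_le: "s \<le> r * (\<epsilon> * s + (1 - \<epsilon>))"
          using real \<open>r \<ge> 0\<close> D by (simp add: ennreal_le_iff)
        have "T / (ennreal \<epsilon> * T + ennreal (1 - \<epsilon>)) \<le> ennreal r"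
        \<comment> \<open>For \<open>s = 0\<close> and \<open>\<epsilon> = 1\<close> the quotient is
          \<open>0 / 0\<close>, which is \<open>0\<close> in the extended nonnegative reals.
          Otherwise the denominator is positive and real division applies.\<close>
        proof (cases "s = 0")
          case False
          then have D: "0 < \<epsilon> * s + (1 - \<epsilon>)"
            using \<epsilon> assms(7) \<open>s \<ge> 0\<close> by (intro saturation_denominator_pos) auto
          have "ennreal \<epsilon> * T + ennreal (1 - \<epsilon>) = ennreal (\<epsilon> * s + (1 - \<epsilon>))"
            using real \<epsilon> assms(7) by (simp add: ennreal_mult ennreal_plus)
          then have "T / (ennreal \<epsilon> * T + ennreal (1 - \<epsilon>)) = ennreal (s / (\<epsilon> * s + (1 - \<epsilon>)))"
            using D real by (simp add: divide_ennreal)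
          also have "\<dots> \<le> ennreal r"
            using s_le D by (intro ennreal_leI) (simp add: pos_divide_le_eq)
          finally show ?thesis .
        qed (use real in simp)
        then show ?thesis using real \<open>E = ennreal r\<close> by (simp add: E_def)
      qed
    qed
  qed
qed

end
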